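(* Suppose $Y\in\mathbb{R}^{n\times r}$ satisfies $\|Y\|_2<(1-\beta)\sqrt n$ for some $0<\beta<1$, and $\mathrm{dist}(Y,\mathcal{B}_{n,r})<\frac{\beta\sqrt n}{\sqrt n+1}<1$. Then $\mathcal{F}(Y)\neq\emptyset$.
   Context: $\mathcal{B}_{n,r}:=\{R\in\mathbb{R}^{n\times r}:\ \mathrm{diag}(RR^\top)=e,\ R^\top e=0\}$, where $e\in\mathbb{R}^n$ is the all-ones vector and $\mathrm{diag}(X)$ is the diagonal vector of $X$. $\|\cdot\|_2$ is the spectral norm and $\mathrm{dist}$ is the Frobenius distance to a set. $[Y]:=\{Y+eb^\top:\ b\in\mathbb{R}^r\}$. For a matrix with every row nonzero, $\mathcal{O}(\cdot)$ normalizes each row to unit $2$-norm. $\mathcal{F}(Y):=\{\mathcal{O}(Y_1):\ Y_1\in[Y]\text{ with every row of }Y_1\text{ nonzero}\}\cap\mathcal{B}_{n,r}$. *)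

theory Defs
  imports "HOL-Analysis.Analysis" "HOL-Library.Extended_Real"
begin

text \<open>An \<open>n \<times> r\<close> real matrix is a value of type \<^typ>\<open>real^'r^'n\<close>, with
  \<open>n = CARD('n)\<close> and \<open>r = CARD('r)\<close>; on this type \<^term>\<open>norm\<close> is the Frobenius norm.\<close>

lemma norm_eq_frobenius:
  fixes Y :: "real^'r^'n"
  shows "norm Y = sqrt (\<Sum>i\<in>UNIV. \<Sum>j\<in>UNIV. (Y $ i $ j)\<^sup>2)"
  by (simp add: norm_vec_def L2_set_def sum_nonneg)

definition all_ones :: "real^'n" where
  "all_ones = (\<chi> i. 1)"

definition diag_vec :: "real^'n^'n \<Rightarrow> real^'n" where
  "diag_vec X = (\<chi> i. X $ i $ i)"

definition outer :: "real^'n \<Rightarrow> real^'r \<Rightarrow> real^'r^'n" where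
  "outer u v = (\<chi> i j. u $ i * v $ j)"

definition spectral_norm :: "real^'r^'n \<Rightarrow> real" where
  "spectral_norm Y = onorm ((*v) Y)"

definition balanced_set :: "(real^'r^'n) set" where
  "balanced_set = {R. diag_vec (R ** transpose R) = all_ones \<and> transpose R *v all_ones = 0}"

text \<open>The distance is extended-real valued because \<^term>\<open>balanced_set\<close> may be empty (for
  \<open>n = 1\<close>, or for \<open>r = 1\<close> and odd \<open>n\<close>). The distance to the empty set is then \<open>\<infinity>\<close>,
  whereas \<^term>\<open>infdist Y {}\<close> is \<open>0\<close>. On nonempty sets the two agree.\<close>

definition frob_dist :: "real^'r^'n \<Rightarrow> (real^'r^'n) set \<Rightarrow> ereal" where
  "frob_dist Y S = (INF R\<in>S. ereal (norm (Y - R)))"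

lemma frob_dist_eq_infdist:
  assumes "S \<noteq> {}"
  shows "frob_dist Y S = ereal (infdist Y S)"
proof -
  have "bdd_below (dist Y ` S)" by (rule bdd_belowI[of _ 0]) auto
  then have "ereal (Inf (dist Y ` S)) = (INF x\<in>dist Y ` S. ereal x)"
    using assms by (intro ereal_Inf') auto
  then show ?thesis
    using assms by (simp add: frob_dist_def infdist_def dist_norm image_image)
qed

lemma frob_dist_empty: "frob_dist Y {} = \<infinity>"
  by (simp add: frob_dist_def top_ereal_def)

definition translation_class :: "real^'r^'n \<Rightarrow> (real^'r^'n) set" where
  "translation_class Y = {Y + outer all_ones b | b. True}"

definition rows_nonzero :: "real^'r^'n \<Rightarrow> bool" where
  "rows_nonzero Y \<longleftrightarrow> (\<forall>i. row i Y \<noteq> 0)"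

text \<open>Only meaningful under \<^term>\<open>rows_nonzero\<close>: a zero row is mapped to zero.\<close>

definition row_normalize :: "real^'r^'n \<Rightarrow> real^'r^'n" where
  "row_normalize Y = (\<chi> i. row i Y /\<^sub>R norm (row i Y))"

definition feasible_roundings :: "real^'r^'n \<Rightarrow> (real^'r^'n) set" where
  "feasible_roundings Y =
     {row_normalize Y1 | Y1. Y1 \<in> translation_class Y \<and> rows_nonzero Y1} \<inter> balanced_set"

end

theory Submission
  imports Defs
begin

text \<open>
  Write \<open>y\<^sub>i\<close> for the rows of \<open>Y\<close>. A feasible rounding is a vector \<open>b\<close> such that no
  \<open>y\<^sub>i + b\<close> vanishes and the field \<open>F b = (\<Sum>i. sgn (y\<^sub>i + b))\<close> is zero at \<open>b\<close>. Such a \<open>b\<close> is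
  found in the ball of radius \<open>1 / \<surd>n\<close>, where \<open>F\<close> is continuous and points outward on the
  boundary: Brouwer's theorem then gives a zero (\<open>outward_field_has_zero\<close>).

  Let \<open>\<delta>\<close> be the bound on the distance and let \<open>R\<close> be a balanced matrix at distance \<open>\<epsilon> < \<delta>\<close>
  from \<open>Y\<close>. The value of \<open>\<delta>\<close> is the one for which \<open>(1 - \<beta>) \<surd>n + \<delta> = (1 - \<delta>) \<surd>n\<close>, so that
  every matrix within \<open>\<epsilon>\<close> of \<open>Y\<close>, \<open>R\<close> included, has spectral norm below \<open>(1 - \<delta>) \<surd>n\<close>. As \<open>R\<close>
  has a unit row, its spectral norm is at least 1, hence \<open>1 / \<surd>n < 1 - \<delta>\<close>. Since
  the \<open>y\<^sub>i\<close> have norm at least \<open>1 - \<epsilon>\<close>, no \<open>y\<^sub>i + b\<close> vanishes on the ball.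

  For the boundary, suppose that \<open>b \<bullet> F b \<le> 0\<close>, and let \<open>G\<close> be the matrix with rows
  \<open>sgn (y\<^sub>i + b)\<close>. Among matrices with unit rows, \<open>G\<close> is nearest to \<open>Y + e b\<^sup>T\<close>; together with
  \<open>b \<bullet> F b \<le> 0\<close> and the balance of \<open>R\<close>, this makes \<open>G\<close> at least as close to \<open>Y\<close> as \<open>R\<close> is
  (\<open>sgn_dist_le\<close>). On the other hand, \<open>y\<^sub>i\<close> lies on the line through \<open>- b\<close> spanned by the
  \<open>i\<close>-th row of \<open>G\<close>, so \<open>\<parallel>G - Y\<parallel>\<^sup>2 \<ge> n \<parallel>b\<parallel>\<^sup>2 - \<parallel>G b\<parallel>\<^sup>2\<close> (\<open>sgn_dist_ge\<close>). With \<open>\<parallel>b\<parallel> = 1 / \<surd>n\<close>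
  and the bound on the spectral norm of \<open>G\<close> this reads \<open>\<delta>\<^sup>2 > 1 - (1 - \<delta>)\<^sup>2\<close>, that is
  \<open>\<delta> (1 - \<delta>) < 0\<close>, which is absurd.
\<close>

section \<open>Zeros of outward-pointing fields\<close>

text \<open>If \<open>F\<close> had no zero, \<open>- F\<close> rescaled to length \<open>\<rho>\<close> would map the ball into its boundary; at
  a fixed point of that map, \<open>F\<close> would point towards the centre.\<close>

lemma outward_field_has_zero:
  fixes F :: "'a::euclidean_space \<Rightarrow> 'a"
  assumes "0 < \<rho>" and cont: "continuous_on (cball 0 \<rho>) F"
    and outward: "\<And>b. norm b = \<rho> \<Longrightarrow> 0 < b \<bullet> F b"
  obtains b where "norm b \<le> \<rho>" "F b = 0"
proof (rule ccontr)
  assume "\<not> thesis"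
  then have nz: "F b \<noteq> 0" if "norm b \<le> \<rho>" for b
    using that \<open>\<And>b. norm b \<le> \<rho> \<Longrightarrow> F b = 0 \<Longrightarrow> thesis\<close> by blast
  define h where "h b = - (\<rho> / norm (F b)) *\<^sub>R F b" for b
  have h_norm: "norm (h b) = \<rho>" if "norm b \<le> \<rho>" for b
    using nz[OF that] \<open>0 < \<rho>\<close> by (simp add: h_def)
  have "continuous_on (cball 0 \<rho>) h"
    unfolding h_def using nz by (intro continuous_intros cont) auto
  moreover have "h \<in> cball 0 \<rho> \<rightarrow> cball 0 \<rho>"
    using h_norm by auto
  ultimately obtain b where b: "norm b \<le> \<rho>" "h b = b"
    using brouwer_ball[OF \<open>0 < \<rho>\<close>, of 0 h] by auto
  have "norm b = \<rho>"
    using h_norm[OF b(1)] b(2) by simp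
  have "b \<bullet> F b = h b \<bullet> F b"
    using b(2) by simp
  also have "\<dots> = - (\<rho> / norm (F b) * (F b \<bullet> F b))"
    by (simp add: h_def)
  also have "\<dots> \<le> 0"
    using \<open>0 < \<rho>\<close> by simp
  finally show False
    using outward[OF \<open>norm b = \<rho>\<close>] by simp
qed

section \<open>Normalizing a translated vector\<close>

text \<open>The unit vector nearest to \<open>y + b\<close> is \<open>sgn (y + b)\<close>. The term in \<open>b\<close> is the cost of
  measuring distances from \<open>y\<close> instead; summed over the rows of a matrix, with the
  vectors \<open>r\<close> adding up to zero, it becomes \<open>2 (b \<bullet> F b)\<close> for the field \<open>F\<close> above.\<close>

lemma sgn_dist_le:
  fixes y b r :: "'a::real_inner"
  assumes "norm r = 1" and "y + b \<noteq> 0"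
  shows "(norm (sgn (y + b) - y))\<^sup>2 \<le> (norm (r - y))\<^sup>2 + 2 * (b \<bullet> (sgn (y + b) - r))"
proof -
  let ?z = "y + b" and ?g = "sgn (y + b)"
  have "?g \<bullet> ?g = 1" "r \<bullet> r = 1"
    using assms by (simp_all add: norm_sgn flip: power2_norm_eq_inner)
  moreover have "r \<bullet> ?z \<le> norm ?z"
    using norm_cauchy_schwarz[of r ?z] assms(1) by simp
  moreover have "?g \<bullet> ?z = norm ?z"
    using assms(2) by (simp add: sgn_div_norm dot_square_norm power2_eq_square)
  ultimately show ?thesis
    by (simp add: power2_norm_eq_inner inner_simps inner_commute)
qed

text \<open>Both \<open>y\<close> and \<open>- b\<close> differ by a multiple of \<open>g = sgn (y + b)\<close>, so \<open>g - y\<close> and \<open>b\<close> have the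
  same component orthogonal to \<open>g\<close>. The left-hand side is the squared length of that component.\<close>

lemma sgn_dist_ge:
  fixes y b :: "'a::real_inner"
  assumes "y + b \<noteq> 0"
  shows "(norm b)\<^sup>2 - (sgn (y + b) \<bullet> b)\<^sup>2 \<le> (norm (sgn (y + b) - y))\<^sup>2"
proof -
  define g where "g = sgn (y + b)"
  define c where "c = 1 - norm (y + b)"
  have gg: "g \<bullet> g = 1"
    using assms by (simp add: g_def norm_sgn flip: power2_norm_eq_inner)
  have "norm (y + b) *\<^sub>R g = y + b"
    using assms by (simp add: g_def sgn_div_norm)
  then have "g - y = c *\<^sub>R g + b"
    by (simp add: c_def algebra_simps)
  then have "(norm (g - y))\<^sup>2 = (norm b)\<^sup>2 - (g \<bullet> b)\<^sup>2 + (c + g \<bullet> b)\<^sup>2"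
    by (simp add: power2_norm_eq_inner inner_simps inner_commute gg)
       (simp add: power2_eq_square algebra_simps)
  then show ?thesis
    by (simp add: g_def)
qed

section \<open>Frobenius and spectral norms\<close>

lemma norm_matrix_square: "(norm A)\<^sup>2 = (\<Sum>i\<in>UNIV. (norm (A $ i))\<^sup>2)"
  for A :: "real^'r^'n"
  by (simp add: norm_vec_def L2_set_def sum_nonneg)

lemma norm_mult_vec_square: "(norm (A *v x))\<^sup>2 = (\<Sum>i\<in>UNIV. (A $ i \<bullet> x)\<^sup>2)"
  for A :: "real^'r^'n"
  by (simp add: norm_vec_def L2_set_def sum_nonneg matrix_vector_mul_component)

lemma norm_mult_vec_le_frobenius: "norm (A *v x) \<le> norm A * norm x"
  for A :: "real^'r^'n"
proof (rule power2_le_imp_le)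
  show "(norm (A *v x))\<^sup>2 \<le> (norm A * norm x)\<^sup>2"
    unfolding norm_mult_vec_square power_mult_distrib norm_matrix_square sum_distrib_right
    by (intro sum_mono) (metis power2_norm_eq_inner Cauchy_Schwarz_ineq)
qed simp

lemma norm_mult_vec_le_perturbed:
  fixes A B :: "real^'r^'n"
  shows "norm (A *v x) \<le> (spectral_norm B + norm (A - B)) * norm x"
proof -
  have "A *v x = B *v x + (A - B) *v x"
    by (simp add: matrix_vector_mult_diff_rdistrib)
  then have "norm (A *v x) \<le> norm (B *v x) + norm ((A - B) *v x)"
    by (metis norm_triangle_ineq)
  also have "norm (B *v x) \<le> spectral_norm B * norm x"
    unfolding spectral_norm_def by (intro onorm matrix_vector_mul_bounded_linear)
  also have "norm ((A - B) *v x) \<le> norm (A - B) * norm x"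
    by (rule norm_mult_vec_le_frobenius)
  finally show ?thesis
    by (simp add: algebra_simps)
qed

section \<open>Feasible roundings\<close>

lemma balanced_set_iff:
  "R \<in> balanced_set \<longleftrightarrow> (\<forall>i. norm (R $ i) = 1) \<and> (\<Sum>i\<in>UNIV. R $ i) = 0"
  for R :: "real^'r^'n"
proof -
  have "diag_vec (R ** transpose R) $ i = (norm (R $ i))\<^sup>2" for i
    by (simp add: diag_vec_def matrix_matrix_mult_def transpose_def power2_norm_eq_inner inner_vec_def)
  moreover have "transpose R *v all_ones = (\<Sum>i\<in>UNIV. R $ i)"
    by (simp add: vec_eq_iff matrix_vector_mult_def transpose_def all_ones_def)
  ultimately show ?thesis
    by (simp add: balanced_set_def vec_eq_iff[of "diag_vec _"] all_ones_def abs_square_eq_1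
             del: norm_eq_1)
qed

lemma feasible_roundings_nonempty_if:
  fixes Y :: "real^'r^'n"
  assumes nz: "\<And>i. Y $ i + b \<noteq> 0" and zero: "(\<Sum>i\<in>UNIV. sgn (Y $ i + b)) = 0"
  shows "feasible_roundings Y \<noteq> {}"
proof -
  let ?Z = "Y + outer all_ones b"
  have row: "row i ?Z = Y $ i + b" for i
    by (simp add: row_def outer_def all_ones_def vec_eq_iff)
  have rounded: "row_normalize ?Z $ i = sgn (Y $ i + b)" for i
    by (simp add: row_normalize_def row sgn_div_norm)
  have "?Z \<in> translation_class Y"
    by (auto simp: translation_class_def)
  moreover have "rows_nonzero ?Z"
    by (simp add: rows_nonzero_def row nz)
  moreover have "row_normalize ?Z \<in> balanced_set"
    by (simp add: balanced_set_iff rounded zero nz norm_sgn)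
  ultimately show ?thesis
    unfolding feasible_roundings_def by blast
qed

text \<open>The radius \<open>1 / \<surd>n\<close> is chosen so that the squared norms of \<open>n\<close> copies of \<open>b\<close> add up to 1.\<close>

lemma normalized_field_outward:
  fixes Y R :: "real^'r^'n" and b :: "real^'r"
  assumes R: "R \<in> balanced_set" and nz: "\<And>i. Y $ i + b \<noteq> 0"
    and norm_b: "norm b = 1 / sqrt (real CARD('n))"
    and dist: "norm (R - Y) < \<delta>" and "\<delta> < 1"
    and spectral: "spectral_norm Y + norm (R - Y) \<le> (1 - \<delta>) * sqrt (real CARD('n))"
  shows "0 < b \<bullet> (\<Sum>i\<in>UNIV. sgn (Y $ i + b))"
proof (rule ccontr)
  assume inward: "\<not> 0 < b \<bullet> (\<Sum>i\<in>UNIV. sgn (Y $ i + b))"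
  define G :: "real^'r^'n" where "G = (\<chi> i. sgn (Y $ i + b))"
  have G: "G $ i = sgn (Y $ i + b)" for i
    by (simp add: G_def)
  have unit: "norm (R $ i) = 1" and balanced: "(\<Sum>i\<in>UNIV. R $ i) = 0" for i
    using R by (simp_all add: balanced_set_iff)
  \<comment> \<open>Rounding an inward translate brings the rows no further from \<open>Y\<close> than \<open>R\<close> is.\<close>
  have "(norm (G - Y))\<^sup>2 \<le> (\<Sum>i\<in>UNIV. (norm (R $ i - Y $ i))\<^sup>2 + 2 * (b \<bullet> (G $ i - R $ i)))"
    unfolding norm_matrix_square
    by (intro sum_mono) (simp add: G sgn_dist_le[OF unit nz])
  also have "\<dots> = (norm (R - Y))\<^sup>2 + 2 * (b \<bullet> (\<Sum>i\<in>UNIV. G $ i - R $ i))"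
    by (simp add: norm_matrix_square sum.distrib inner_sum_right flip: sum_distrib_left)
  also have "\<dots> \<le> (norm (R - Y))\<^sup>2"
    using inward by (simp add: sum_subtractf balanced G)
  finally have G_sq: "(norm (G - Y))\<^sup>2 \<le> (norm (R - Y))\<^sup>2" .
  then have GY: "norm (G - Y) \<le> norm (R - Y)"
    by (rule power2_le_imp_le) simp
  \<comment> \<open>Conversely, \<open>G - Y\<close> contains the part of each copy of \<open>b\<close> orthogonal to the row of \<open>G\<close>.\<close>
  have "(\<Sum>i\<in>(UNIV::'n set). (norm b)\<^sup>2) - (norm (G *v b))\<^sup>2 \<le> (norm (G - Y))\<^sup>2"
    unfolding norm_mult_vec_square norm_matrix_square sum_subtractf[symmetric]
    by (intro sum_mono) (simp add: G sgn_dist_ge[OF nz])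
  then have lower: "1 - (norm (G *v b))\<^sup>2 \<le> (norm (G - Y))\<^sup>2"
    by (simp add: norm_b power_divide)
  have "norm (G *v b) \<le> (spectral_norm Y + norm (G - Y)) * norm b"
    by (rule norm_mult_vec_le_perturbed)
  also have "\<dots> \<le> (1 - \<delta>) * sqrt (real CARD('n)) * norm b"
    using GY spectral by (intro mult_right_mono) auto
  also have "\<dots> = 1 - \<delta>"
    by (simp add: norm_b)
  finally have "(norm (G *v b))\<^sup>2 \<le> (1 - \<delta>)\<^sup>2"
    by (intro power_mono) auto
  moreover have "(norm (R - Y))\<^sup>2 < \<delta>\<^sup>2"
    using dist by (intro power_strict_mono) auto
  ultimately have "1 - (1 - \<delta>)\<^sup>2 < \<delta>\<^sup>2"
    using lower G_sq by linarith
  moreover have "0 < \<delta> * (1 - \<delta>)"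
    using dist \<open>\<delta> < 1\<close> norm_ge_zero[of "R - Y"] by (intro mult_pos_pos) linarith+
  ultimately show False
    by (simp add: power2_eq_square algebra_simps)
qed

theorem theorem3p9:
  fixes Y :: "real^'r^'n" and \<beta> :: real
  assumes "0 < \<beta>" and "\<beta> < 1"
    and "spectral_norm Y < (1 - \<beta>) * sqrt (real CARD('n))"
    and "frob_dist Y balanced_set
           < ereal (\<beta> * sqrt (real CARD('n)) / (sqrt (real CARD('n)) + 1))"
    and "\<beta> * sqrt (real CARD('n)) / (sqrt (real CARD('n)) + 1) < 1"
  shows "feasible_roundings Y \<noteq> {}"
proof -
  define s where "s = sqrt (real CARD('n))"
  define \<delta> where "\<delta> = \<beta> * s / (s + 1)"
  have "0 < s"
    by (simp add: s_def)
  have "\<delta> < 1"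
    using assms(5) by (simp add: \<delta>_def s_def)
  obtain R :: "real^'r^'n" where R: "R \<in> balanced_set" and "norm (Y - R) < \<delta>"
    using assms(4) by (auto simp: frob_dist_def INF_less_iff \<delta>_def s_def)
  then have dist: "norm (R - Y) < \<delta>"
    by (simp add: norm_minus_commute)
  have unit: "norm (R $ i) = 1" for i
    using R by (simp add: balanced_set_iff)
  have "(1 - \<beta>) * s + \<delta> = (1 - \<delta>) * s"
    using \<open>0 < s\<close> by (simp add: \<delta>_def field_simps)
  then have spectral: "spectral_norm Y + norm (R - Y) < (1 - \<delta>) * s"
    using assms(3) dist by (simp add: s_def)
  have radius: "1 / s < 1 - \<delta>"
  proof -
    \<comment> \<open>Testing \<open>R\<close> on one of its own unit rows shows that its spectral norm is at least 1.\<close>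
    fix k :: 'n
    have "1 = (R *v (R $ k)) $ k"
      using unit[of k] by (simp add: matrix_vector_mul_component dot_square_norm)
    also have "\<dots> \<le> norm (R *v (R $ k))"
      using component_le_norm_cart[of "R *v (R $ k)" k] by simp
    also have "\<dots> \<le> spectral_norm Y + norm (R - Y)"
      using norm_mult_vec_le_perturbed[of R "R $ k" Y] by (simp add: unit)
    finally show ?thesis
      using spectral \<open>0 < s\<close> by (simp add: field_simps)
  qed
  have nz: "Y $ i + b \<noteq> 0" if "norm b \<le> 1 / s" for b i
  proof
    assume "Y $ i + b = 0"
    then have "R $ i = (R - Y) $ i - b"
      by (simp add: algebra_simps add_eq_0_iff)
    then have "norm (R $ i) \<le> norm ((R - Y) $ i) + norm b"
      by (metis norm_triangle_ineq4)
    also have "norm ((R - Y) $ i) \<le> norm (R - Y)"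
      by (rule Finite_Cartesian_Product.norm_nth_le)
    finally show False
      using that dist radius unit[of i] by simp
  qed
  have "continuous_on (cball 0 (1 / s)) (\<lambda>b. \<Sum>i\<in>UNIV. sgn (Y $ i + b))"
    using nz by (intro continuous_intros) auto
  moreover have "0 < b \<bullet> (\<Sum>i\<in>UNIV. sgn (Y $ i + b))" if "norm b = 1 / s" for b
    using normalized_field_outward[OF R _ _ dist \<open>\<delta> < 1\<close>] nz spectral that
    by (simp add: s_def)
  ultimately obtain b where "norm b \<le> 1 / s" "(\<Sum>i\<in>UNIV. sgn (Y $ i + b)) = 0"
    using outward_field_has_zero[of "1 / s"] \<open>0 < s\<close> by auto
  then show ?thesis
    by (intro feasible_roundings_nonempty_if[of Y b] nz)
qed

end
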